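(* Let $G=(V,E,\vartheta,w)$ be a connected, locally finite, stochastically complete weighted graph with $D^{\epsilon}_{\vartheta}<\infty$, $\vartheta_{\max}<\infty$ and $\omega_{\min}>0$, and let $\epsilon\in(0,1)$. Suppose $u=u(x,t)>0$ is a solution on $V\times(0,\infty)$ of the fractional diffusion equation $$\Delta^{\epsilon}u-b(x,t)u=u_t+\gamma(t)u$$ with $|b(x,t)|\le C_0$ and $\gamma(t)\le c_1+\frac{c_2}{t}$ for constants $C_0,c_1,c_2\in\mathbb{R}$. Let $x,y\in V$, $d(x,y)=\eta$, and consider any shortest path $x=x_0\sim x_1\sim\cdots\sim x_\eta=y$. For any $0<T_1<T_2$, partition the time interval by $t_k=T_1+\frac{k}{\eta}(T_2-T_1)$, $k=0,\dots,\eta$. Then for any monotonically decreasing function $\alpha(t)\ge1$ on $[T_1,T_2]$, $$u(x,T_1)\le u(y,T_2)\left(\frac{T_2}{T_1}\right)^{c_2}\exp\Bigg\{(2D^{\epsilon}_{\vartheta}+C_0+c_1)(T_2-T_1)+\inf_{\Gamma}\sum_{k=0}^{\eta-1}\frac{8\vartheta_{\max}I_k}{\omega_{\min}(T_2-T_1)^3}\Bigg\},$$ where $I_k=\int_{t_k}^{t_{k+1}}d\theta\int_{t_k}^{\theta}\alpha(t)\,dt$ and the infimum is taken over all shortest paths $\Gamma$ connecting $x$ and $y$. In particular, when $\alpha(t)\equiv1$, $$u(x,T_1)\le u(y,T_2)\left(\frac{T_2}{T_1}\right)^{c_2}\exp\left\{(2D^{\epsilon}_{\vartheta}+C_0+c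_1)(T_2-T_1)+\frac{4\vartheta_{\max}\eta^2}{\omega_{\min}(T_2-T_1)}\right\}.$$
   Context: $G=(V,E,\vartheta,w)$ is a graph with vertex set $V$, edge set $E$, vertex measure $\vartheta:V\to(0,\infty)$ and symmetric edge weights $w_{xy}=w_{yx}>0$ if $x\sim y$ (adjacent), $w_{xy}=0$ otherwise. Locally finite: every vertex has finitely many neighbors. The distance $d(x,y)$ is the number of edges of a shortest path from $x$ to $y$. Let $p_t(x,y)$ be the heat kernel of $G$ (associated with $\Delta f(x)=\frac{1}{\vartheta(x)}\sum_{y\sim x}w_{xy}(f(y)-f(x))$). $G$ is stochastically complete if $\sum_{y\in V}p_t(x,y)\vartheta(y)=1$ for all $t>0$, $x\in V$. For $\epsilon\in(0,1)$ and $x\ne y$, $W_{\epsilon}(x,y)=\frac{\epsilon}{\Gamma(1-\epsilon)}\vartheta(x)\vartheta(y)\int_0^{\infty}p_t(x,y)t^{-1-\epsilon}\,dt$, where $\Gamma(1-\epsilon)$ is the Gamma function. For $f:V\to\mathbb{R}$, $$\Delta^{\epsilon}f(x)=\frac{1}{\vartheta(x)}\sum_{y\in V,\,y\ne x}W_{\epsilon}(x,y)(f(y)-f(x)).$$ Constants: $D^{\epsilon}_{\vartheta}:=\max_{x\in V}\frac{\sum_{y\ne x}W_{\epsilon}(x,y)}{\vartheta(x)}$, $\vartheta_{\max}:=\sup_{x\in V}\vartheta(x)$, $\omega_{\min}:=\inf_{x,y\in V,\,x\ne y}W_{\epsilon}(x,y)$. Operators act in the vertex variable and $u_t$ is the time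 derivative.
   Formalization: In the first inequality the summand carries an extra factor η³, i.e. 8ϑ_max η³ I_k/(ω_min(T₂−T₁)³); the printed bound fails on long unit-weight path graphs with ε near 0, and only the corrected one reduces to the stated case α≡1. *)

theory Defs
  imports "HOL-Analysis.Analysis"
begin

text \<open>A weighted graph \<open>(V, E, \<theta>, w)\<close> has the whole type \<open>'v\<close> as its vertex set. Loops are
  not excluded; they affect neither the Laplacian nor the shortest paths.\<close>

definition weighted_graph :: "'v rel \<Rightarrow> ('v \<Rightarrow> real) \<Rightarrow> ('v \<Rightarrow> 'v \<Rightarrow> real) \<Rightarrow> bool" where
  "weighted_graph E \<theta> w \<longleftrightarrow>
     (\<forall>x. \<theta> x > 0) \<and>
     (\<forall>x y. w x y = w y x) \<and>
     (\<forall>x y. (x, y) \<in> E \<longrightarrow> w x y > 0) \<and>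
     (\<forall>x y. (x, y) \<notin> E \<longrightarrow> w x y = 0)"

definition locally_finite_graph :: "'v rel \<Rightarrow> bool" where
  "locally_finite_graph E \<longleftrightarrow> (\<forall>x. finite (E `` {x}))"

definition connected_graph :: "'v rel \<Rightarrow> bool" where
  "connected_graph E \<longleftrightarrow> (\<forall>x y. (x, y) \<in> E\<^sup>*)"

definition graph_dist :: "'v rel \<Rightarrow> 'v \<Rightarrow> 'v \<Rightarrow> nat" where
  "graph_dist E x y = (LEAST n. (x, y) \<in> E ^^ n)"

definition shortest_paths :: "'v rel \<Rightarrow> 'v \<Rightarrow> 'v \<Rightarrow> 'v list set" where
  "shortest_paths E x y =
     {xs. length xs = Suc (graph_dist E x y) \<and> xs ! 0 = x \<and> xs ! graph_dist E x y = y \<and>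
          (\<forall>k < graph_dist E x y. (xs ! k, xs ! Suc k) \<in> E)}"

definition laplacian ::
  "'v rel \<Rightarrow> ('v \<Rightarrow> real) \<Rightarrow> ('v \<Rightarrow> 'v \<Rightarrow> real) \<Rightarrow> ('v \<Rightarrow> real) \<Rightarrow> 'v \<Rightarrow> real" where
  "laplacian E \<theta> w f x = (\<Sum>y\<in>E `` {x}. w x y * (f y - f x)) / \<theta> x"

text \<open>The heat kernel is the minimal one. On a finite set \<open>U\<close> of vertices the Dirichlet heat
  kernel is the kernel, with respect to \<open>\<theta>\<close>, of \<open>exp (t \<Delta>\<^sub>U)\<close>, where \<open>\<Delta>\<^sub>U\<close> is the
  (bounded) Laplacian with zero boundary values outside \<open>U\<close>. These kernels increase with \<open>U\<close> and
  are bounded, so they converge along the directed set of finite vertex sets, to the same limit as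
  along any exhaustion of the graph.\<close>

definition dirichlet_laplacian ::
  "'v rel \<Rightarrow> ('v \<Rightarrow> real) \<Rightarrow> ('v \<Rightarrow> 'v \<Rightarrow> real) \<Rightarrow> 'v set \<Rightarrow> ('v \<Rightarrow> real) \<Rightarrow> 'v \<Rightarrow> real" where
  "dirichlet_laplacian E \<theta> w U f =
     (\<lambda>x. if x \<in> U then laplacian E \<theta> w (\<lambda>z. if z \<in> U then f z else 0) x else 0)"

definition dirichlet_heat_kernel ::
  "'v rel \<Rightarrow> ('v \<Rightarrow> real) \<Rightarrow> ('v \<Rightarrow> 'v \<Rightarrow> real) \<Rightarrow> 'v set \<Rightarrow> real \<Rightarrow> 'v \<Rightarrow> 'v \<Rightarrow> real" where
  "dirichlet_heat_kernel E \<theta> w U t x y =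
     (\<Sum>n. t ^ n / fact n *
        (dirichlet_laplacian E \<theta> w U ^^ n) (\<lambda>z. if z = y \<and> z \<in> U then 1 / \<theta> y else 0) x)"

definition heat_kernel ::
  "'v rel \<Rightarrow> ('v \<Rightarrow> real) \<Rightarrow> ('v \<Rightarrow> 'v \<Rightarrow> real) \<Rightarrow> real \<Rightarrow> 'v \<Rightarrow> 'v \<Rightarrow> real" where
  "heat_kernel E \<theta> w t x y =
     Lim (finite_subsets_at_top UNIV) (\<lambda>U. dirichlet_heat_kernel E \<theta> w U t x y)"

definition stochastically_complete ::
  "'v rel \<Rightarrow> ('v \<Rightarrow> real) \<Rightarrow> ('v \<Rightarrow> 'v \<Rightarrow> real) \<Rightarrow> bool" where
  "stochastically_complete E \<theta> w \<longleftrightarrow>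
     (\<forall>t>0. \<forall>x. ((\<lambda>y. heat_kernel E \<theta> w t x y * \<theta> y) has_sum 1) UNIV)"

definition frac_weight ::
  "'v rel \<Rightarrow> ('v \<Rightarrow> real) \<Rightarrow> ('v \<Rightarrow> 'v \<Rightarrow> real) \<Rightarrow> real \<Rightarrow> 'v \<Rightarrow> 'v \<Rightarrow> real" where
  "frac_weight E \<theta> w \<epsilon> x y =
     \<epsilon> / Gamma (1 - \<epsilon>) * \<theta> x * \<theta> y *
     (LINT t:{0<..}|lborel. heat_kernel E \<theta> w t x y * t powr (- 1 - \<epsilon>))"

definition frac_laplacian ::
  "'v rel \<Rightarrow> ('v \<Rightarrow> real) \<Rightarrow> ('v \<Rightarrow> 'v \<Rightarrow> real) \<Rightarrow> real \<Rightarrow> ('v \<Rightarrow> real) \<Rightarrow> 'v \<Rightarrow> real" where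
  "frac_laplacian E \<theta> w \<epsilon> f x =
     (\<Sum>\<^sub>\<infinity>y\<in>-{x}. frac_weight E \<theta> w \<epsilon> x y * (f y - f x)) / \<theta> x"

text \<open>The three constants are extended nonnegative numbers, so that their finiteness and positivity
  can be stated. No truncation takes place in \<open>ennreal\<close>, since the measure and the fractional weights
  are nonnegative. On a one-vertex graph \<open>omega_min\<close> is the infimum of the empty set, \<open>\<infinity>\<close>.\<close>

definition frac_degree_sup ::
  "'v rel \<Rightarrow> ('v \<Rightarrow> real) \<Rightarrow> ('v \<Rightarrow> 'v \<Rightarrow> real) \<Rightarrow> real \<Rightarrow> ennreal" where
  "frac_degree_sup E \<theta> w \<epsilon> =
     (SUP x. (\<Sum>\<^sub>\<infinity>y\<in>-{x}. ennreal (frac_weight E \<theta> w \<epsilon> x y)) / ennreal (\<theta> x))"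

definition measure_max :: "('v \<Rightarrow> real) \<Rightarrow> ennreal" where
  "measure_max \<theta> = (SUP x. ennreal (\<theta> x))"

definition omega_min ::
  "'v rel \<Rightarrow> ('v \<Rightarrow> real) \<Rightarrow> ('v \<Rightarrow> 'v \<Rightarrow> real) \<Rightarrow> real \<Rightarrow> ennreal" where
  "omega_min E \<theta> w \<epsilon> = (INF (x, y)\<in>{(x, y). x \<noteq> y}. ennreal (frac_weight E \<theta> w \<epsilon> x y))"

text \<open>Being a solution includes that the series defining the fractional Laplacian converges.\<close>

definition frac_diffusion_solution ::
  "'v rel \<Rightarrow> ('v \<Rightarrow> real) \<Rightarrow> ('v \<Rightarrow> 'v \<Rightarrow> real) \<Rightarrow> real \<Rightarrow>
   ('v \<Rightarrow> real \<Rightarrow> real) \<Rightarrow> (real \<Rightarrow> real) \<Rightarrow> ('v \<Rightarrow> real \<Rightarrow> real) \<Rightarrow> bool" where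
  "frac_diffusion_solution E \<theta> w \<epsilon> b \<gamma> u \<longleftrightarrow>
     (\<forall>x. \<forall>t>0.
        (\<lambda>y. frac_weight E \<theta> w \<epsilon> x y * (u y t - u x t)) summable_on -{x} \<and>
        u x differentiable at t \<and>
        frac_laplacian E \<theta> w \<epsilon> (\<lambda>z. u z t) x - b x t * u x t = deriv (u x) t + \<gamma> t * u x t)"

text \<open>The mesh of the partition is \<open>(T2 - T1) / \<eta>\<close>. The path terms of the Harnack inequality
  divide \<open>time_weight\<close> by its cube, which is where the factor \<open>\<eta> ^ 3 / (T2 - T1) ^ 3\<close> comes from;
  for constant \<open>\<alpha> = 1\<close> each \<open>time_weight\<close> is half the squared mesh, so the sum over the
  \<open>\<eta>\<close> steps is of order \<open>\<eta>\<^sup>2 / (T2 - T1)\<close>. The factor cannot be dropped: on a path graph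
  with unit weights and \<open>\<epsilon>\<close> close to \<open>0\<close> the bound without it fails for large \<open>\<eta>\<close>.\<close>

definition time_node :: "real \<Rightarrow> real \<Rightarrow> nat \<Rightarrow> nat \<Rightarrow> real" where
  "time_node T1 T2 \<eta> k = T1 + real k / real \<eta> * (T2 - T1)"

definition time_weight :: "(real \<Rightarrow> real) \<Rightarrow> real \<Rightarrow> real \<Rightarrow> nat \<Rightarrow> nat \<Rightarrow> real" where
  "time_weight \<alpha> T1 T2 \<eta> k =
     integral {time_node T1 T2 \<eta> k..time_node T1 T2 \<eta> (Suc k)}
       (\<lambda>s. integral {time_node T1 T2 \<eta> k..s} \<alpha>)"

end

theory Submission
  imports Defs
begin

text \<open>
  Why the inequality holds. The hypothesis \<open>omega_min > 0\<close> makes any two distinct vertices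
  interact: the fractional Laplacian at \<open>y\<close> sees \<open>u x\<close> directly, with a weight of at least
  \<open>omega_min\<close>, however far apart \<open>x\<close> and \<open>y\<close> are in the graph. A single jump therefore replaces
  the usual chain of estimates along a path.

  Since \<open>u > 0\<close>, all gain terms \<open>W(z, z') u(z')\<close> are positive, while the total loss at \<open>z\<close> is
  at most \<open>D u(z)\<close> (\<open>frac_laplacian_lower_bound\<close>). Multiplying \<open>u\<close> by the integrating factor
  \<open>exp ((D + C\<^sub>0 + c\<^sub>1) t) (t powr c\<^sub>2)\<close> absorbs the loss and the bounds on \<open>b\<close> and \<open>\<gamma>\<close>.
  The product \<open>v\<close> is nondecreasing in time and satisfies \<open>v(y)' \<ge> (\<omega> / M) v(x)\<close> for \<open>x \<noteq> y\<close>,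
  where \<open>\<omega>\<close> and \<open>M\<close> stand for \<open>omega_min\<close> and \<open>measure_max\<close>. Integration over
  \<open>[T\<^sub>1, T\<^sub>2]\<close> gives \<open>v(x, T\<^sub>1) \<le> s v(y, T\<^sub>2)\<close> with \<open>s = M / (\<omega> (T\<^sub>2 - T\<^sub>1))\<close>
  (\<open>normalized_jump\<close>).

  The two exponential bounds are weaker than this: \<open>s \<le> exp s\<close>, \<open>1 \<le> \<eta>\<^sup>2\<close> and \<open>D \<le> 2 D\<close> yield
  the bound with \<open>4 \<eta>\<^sup>2 s\<close> in the exponent. For a weight \<open>\<alpha> \<ge> 1\<close> each double integral of \<open>\<alpha>\<close>
  over a cell is at least half the squared mesh, so the path term is at least \<open>4 \<eta>\<^sup>2 s\<close> too
  (\<open>path_term_lower_bound\<close>); it is the same for all shortest paths, so the infimum changes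
  nothing. If \<open>x = y\<close> then \<open>\<eta> = 0\<close>, and the monotonicity of \<open>v\<close> suffices.
\<close>

section \<open>Double integrals over the cells of the time partition\<close>

lemma double_integral_ge_half_square:
  fixes \<alpha> :: "real \<Rightarrow> real"
  assumes "a \<le> b" and int: "\<alpha> integrable_on {a..b}" and ge1: "\<And>t. t \<in> {a..b} \<Longrightarrow> \<alpha> t \<ge> 1"
  shows "(b - a)\<^sup>2 / 2 \<le> integral {a..b} (\<lambda>s. integral {a..s} \<alpha>)"
proof -
  \<comment> \<open>The inner integral is at least the distance to the left endpoint, whose integral is known.\<close>
  have inner: "s - a \<le> integral {a..s} \<alpha>" if "s \<in> {a..b}" for s
  proof -
    have "integral {a..s} (\<lambda>_. 1) \<le> integral {a..s} \<alpha>"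
      using that ge1 by (intro integral_le integrable_subinterval_real[OF int]) auto
    then show ?thesis using that by simp
  qed
  have "((\<lambda>s. s - a) has_integral ((b - a)\<^sup>2 / 2 - (a - a)\<^sup>2 / 2)) {a..b}"
    using assms(1)
    by (intro fundamental_theorem_of_calculus)
       (auto intro!: derivative_eq_intros simp flip: has_real_derivative_iff_has_vector_derivative)
  then have hi: "((\<lambda>s. s - a) has_integral (b - a)\<^sup>2 / 2) {a..b}" by simp
  have "(\<lambda>s. integral {a..s} \<alpha>) integrable_on {a..b}"
    using indefinite_integral_continuous_1[OF int] by (rule integrable_continuous_real)
  then show ?thesis
    using integral_le[OF has_integral_integrable[OF hi] _ inner] integral_unique[OF hi] by simp
qed

lemma time_weight_lower_bound:
  assumes "T1 < T2" and "k < \<eta>"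
    and "antimono_on {T1..T2} \<alpha>" and ge1: "\<And>t. t \<in> {T1..T2} \<Longrightarrow> \<alpha> t \<ge> 1"
  shows "((T2 - T1) / real \<eta>)\<^sup>2 / 2 \<le> time_weight \<alpha> T1 T2 \<eta> k"
proof -
  let ?a = "time_node T1 T2 \<eta> k" and ?b = "time_node T1 T2 \<eta> (Suc k)"
  have mesh: "?b - ?a = (T2 - T1) / real \<eta>"
    using \<open>k < \<eta>\<close> by (simp add: time_node_def field_simps)
  have "T1 \<le> ?a" using assms(1) by (simp add: time_node_def)
  have "real (Suc k) / real \<eta> \<le> 1" using \<open>k < \<eta>\<close> by simp
  then have "real (Suc k) / real \<eta> * (T2 - T1) \<le> 1 * (T2 - T1)"
    using assms(1) by (intro mult_right_mono) auto
  then have "?b \<le> T2" by (simp add: time_node_def)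
  have sub: "{?a..?b} \<subseteq> {T1..T2}" using \<open>T1 \<le> ?a\<close> \<open>?b \<le> T2\<close> by auto
  \<comment> \<open>A monotone function is integrable, even where it is discontinuous.\<close>
  have "mono_on {T1..T2} (\<lambda>t. - \<alpha> t)"
    using assms(3) by (auto simp: monotone_on_def)
  then have "(\<lambda>t. - (- \<alpha> t)) integrable_on {T1..T2}"
    by (intro integrable_neg integrable_on_mono_on)
  then have "\<alpha> integrable_on {?a..?b}"
    using integrable_subinterval_real[OF _ sub] by simp
  moreover have "?a \<le> ?b" using mesh assms(1) by (smt (verit) divide_nonneg_nonneg of_nat_0_le_iff)
  ultimately show ?thesis
    using double_integral_ge_half_square[of ?a ?b \<alpha>] ge1 sub mesh
    unfolding time_weight_def by auto
qed

text \<open>The bound is an equality for \<open>\<alpha> = 1\<close>, so the estimate for the constant weight implies the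
  estimate for every other weight.\<close>

lemma path_term_lower_bound:
  fixes M \<omega> :: real
  assumes "T1 < T2" and "M \<ge> 0" and "\<omega> \<ge> 0"
    and "antimono_on {T1..T2} \<alpha>" and "\<And>t. t \<in> {T1..T2} \<Longrightarrow> \<alpha> t \<ge> 1"
  shows "4 * M * real \<eta> ^ 2 / (\<omega> * (T2 - T1))
      \<le> (\<Sum>k<\<eta>. 8 * M * real \<eta> ^ 3 * time_weight \<alpha> T1 T2 \<eta> k / (\<omega> * (T2 - T1) ^ 3))"
proof (cases "\<eta> = 0 \<or> \<omega> = 0")
  case False
  let ?c = "8 * M * real \<eta> ^ 3 / (\<omega> * (T2 - T1) ^ 3)"
  have "4 * M * real \<eta> ^ 2 / (\<omega> * d)
      = real \<eta> * (8 * M * real \<eta> ^ 3 / (\<omega> * d ^ 3) * ((d / real \<eta>)\<^sup>2 / 2))"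
    if "d \<noteq> 0" for d
    using False that by (simp add: field_simps eval_nat_numeral)
  from this[of "T2 - T1"]
  have "4 * M * real \<eta> ^ 2 / (\<omega> * (T2 - T1)) = (\<Sum>k<\<eta>. ?c * (((T2 - T1) / real \<eta>)\<^sup>2 / 2))"
    using assms(1) by simp
  also have "\<dots> \<le> (\<Sum>k<\<eta>. ?c * time_weight \<alpha> T1 T2 \<eta> k)"
    using assms by (intro sum_mono mult_left_mono time_weight_lower_bound) auto
  finally show ?thesis by (simp add: mult_ac)
qed auto

section \<open>Shortest paths\<close>

text \<open>A real infimum bounds anything only over a nonempty set.\<close>

lemma shortest_paths_nonempty:
  assumes "connected_graph E"
  shows "shortest_paths E x y \<noteq> {}"
proof -
  let ?n = "graph_dist E x y"
  have "\<exists>n. (x, y) \<in> E ^^ n"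
    using assms unfolding connected_graph_def by (meson rtrancl_imp_relpow)
  then have "(x, y) \<in> E ^^ ?n" unfolding graph_dist_def by (rule LeastI_ex)
  then obtain f where "f 0 = x" "f ?n = y" "\<forall>i<?n. (f i, f (Suc i)) \<in> E"
    unfolding relpow_fun_conv by auto
  then have "map f [0..<Suc ?n] \<in> shortest_paths E x y"
    unfolding shortest_paths_def by (auto simp del: upt_Suc)
  then show ?thesis by blast
qed

lemma graph_dist_eq_0_iff:
  assumes "connected_graph E"
  shows "graph_dist E x y = 0 \<longleftrightarrow> x = y"
proof
  assume "graph_dist E x y = 0"
  moreover obtain p where "p \<in> shortest_paths E x y" using shortest_paths_nonempty[OF assms] by blast
  ultimately show "x = y" by (auto simp: shortest_paths_def)
qed (auto simp: graph_dist_def intro: Least_eq_0)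

section \<open>The fractional weights\<close>

text \<open>A pair of distinct vertices makes the infimum finite. Its positivity also excludes negative
  weights, which \<open>ennreal\<close> would truncate to \<open>0\<close>.\<close>

lemma omega_min_finite_and_le:
  assumes "omega_min E \<theta> w \<epsilon> > 0" and "x \<noteq> y"
  shows "0 < enn2real (omega_min E \<theta> w \<epsilon>)"
    and "enn2real (omega_min E \<theta> w \<epsilon>) \<le> frac_weight E \<theta> w \<epsilon> x y"
proof -
  have le: "omega_min E \<theta> w \<epsilon> \<le> ennreal (frac_weight E \<theta> w \<epsilon> x y)"
    unfolding omega_min_def
    by (rule INF_lower2[where i = "(x, y)"]) (use assms(2) in auto)
  then have "omega_min E \<theta> w \<epsilon> < \<infinity>" by (rule le_less_trans) simp
  then show pos: "0 < enn2real (omega_min E \<theta> w \<epsilon>)"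
    using assms(1) by (simp add: enn2real_positive_iff)
  have "ennreal (frac_weight E \<theta> w \<epsilon> x y) > 0" using assms(1) le by order
  then have "frac_weight E \<theta> w \<epsilon> x y > 0" by simp
  then show "enn2real (omega_min E \<theta> w \<epsilon>) \<le> frac_weight E \<theta> w \<epsilon> x y"
    using enn2real_mono[OF le] by simp
qed

text \<open>The series in \<open>ennreal\<close> dominates the real partial sums, so its finiteness gives real
  summability. The series of gains and losses can then be split into two convergent series.\<close>

lemma frac_weight_summable:
  assumes "frac_degree_sup E \<theta> w \<epsilon> < \<infinity>" and "\<theta> x > 0"
    and nonneg: "\<And>y. y \<noteq> x \<Longrightarrow> frac_weight E \<theta> w \<epsilon> x y \<ge> 0"
  shows "frac_weight E \<theta> w \<epsilon> x summable_on -{x}"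
    and "(\<Sum>\<^sub>\<infinity>y\<in>-{x}. frac_weight E \<theta> w \<epsilon> x y)
           \<le> enn2real (frac_degree_sup E \<theta> w \<epsilon>) * \<theta> x"
proof -
  let ?W = "frac_weight E \<theta> w \<epsilon> x" and ?D = "frac_degree_sup E \<theta> w \<epsilon>"
  have D: "?D = ennreal (enn2real ?D)" using assms(1) by simp
  have "(\<Sum>\<^sub>\<infinity>y\<in>-{x}. ennreal (?W y)) / ennreal (\<theta> x) \<le> ?D"
    unfolding frac_degree_sup_def by (rule SUP_upper) simp
  then have "(\<Sum>\<^sub>\<infinity>y\<in>-{x}. ennreal (?W y)) / ennreal (\<theta> x) * ennreal (\<theta> x)
      \<le> ?D * ennreal (\<theta> x)"
    by (rule mult_right_mono) simp
  then have total: "(\<Sum>\<^sub>\<infinity>y\<in>-{x}. ennreal (?W y)) \<le> ?D * ennreal (\<theta> x)"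
    using assms(2) by (simp add: ennreal_divide_times)
  have fin: "sum ?W F \<le> enn2real ?D * \<theta> x" if "finite F" "F \<subseteq> -{x}" for F
  proof -
    have "ennreal (sum ?W F) = (\<Sum>y\<in>F. ennreal (?W y))"
      using that nonneg by (intro sum_ennreal[symmetric]) blast
    also have "\<dots> \<le> (\<Sum>\<^sub>\<infinity>y\<in>-{x}. ennreal (?W y))"
      using that by (subst nonneg_infsum_complete) (auto intro: SUP_upper)
    also have "\<dots> \<le> ennreal (enn2real ?D * \<theta> x)"
      using total assms(2) D by (simp add: ennreal_mult)
    finally show ?thesis using assms(2) by (simp add: ennreal_le_iff)
  qed
  show "?W summable_on -{x}"
    using nonneg fin
    by (intro nonneg_bdd_above_summable_on bdd_aboveI2[where M = "enn2real ?D * \<theta> x"]) auto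
  then show "(\<Sum>\<^sub>\<infinity>y\<in>-{x}. ?W y) \<le> enn2real ?D * \<theta> x"
    using fin by (intro infsum_le_finite_sums) auto
qed

text \<open>For \<open>f \<ge> 0\<close> the gains are nonnegative, so any finite part of them bounds their sum from
  below, and the weighted degree controls the loss. The cases used are an empty \<open>F\<close>, for
  monotonicity in time, and a singleton, for one jump.\<close>

lemma frac_laplacian_lower_bound:
  assumes "frac_degree_sup E \<theta> w \<epsilon> < \<infinity>" and "\<theta> x > 0"
    and nonneg: "\<And>y. y \<noteq> x \<Longrightarrow> frac_weight E \<theta> w \<epsilon> x y \<ge> 0"
    and f: "\<And>y. f y \<ge> 0"
    and summ: "(\<lambda>y. frac_weight E \<theta> w \<epsilon> x y * (f y - f x)) summable_on -{x}"
    and F: "finite F" "F \<subseteq> -{x}"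
  shows "(\<Sum>y\<in>F. frac_weight E \<theta> w \<epsilon> x y * f y) / \<theta> x
            - enn2real (frac_degree_sup E \<theta> w \<epsilon>) * f x
         \<le> frac_laplacian E \<theta> w \<epsilon> f x"
proof -
  let ?W = "frac_weight E \<theta> w \<epsilon> x" and ?D = "enn2real (frac_degree_sup E \<theta> w \<epsilon>)"
  note W = frac_weight_summable[of E \<theta> w \<epsilon> x, OF assms(1,2) nonneg]
  have loss: "(\<lambda>y. ?W y * f x) summable_on -{x}"
    using W(1) by (rule summable_on_cmult_left)
  have gain: "(\<lambda>y. ?W y * f y) summable_on -{x}"
    using summable_on_add[OF summ loss] by (simp add: algebra_simps)
  have "(\<Sum>\<^sub>\<infinity>y\<in>-{x}. ?W y * (f y - f x))
      = (\<Sum>\<^sub>\<infinity>y\<in>-{x}. ?W y * f y) - (\<Sum>\<^sub>\<infinity>y\<in>-{x}. ?W y) * f x"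
    using infsum_add[OF summ loss] infsum_cmult_left[of "f x" ?W "-{x}"] W(1)
    by (simp add: algebra_simps)
  moreover have "(\<Sum>y\<in>F. ?W y * f y) \<le> (\<Sum>\<^sub>\<infinity>y\<in>-{x}. ?W y * f y)"
    using gain F nonneg f by (intro finite_sum_le_infsum) auto
  moreover have "(\<Sum>\<^sub>\<infinity>y\<in>-{x}. ?W y) * f x \<le> ?D * \<theta> x * f x"
    using W(2) f by (intro mult_right_mono) auto
  ultimately have "(\<Sum>y\<in>F. ?W y * f y) - ?D * \<theta> x * f x
      \<le> (\<Sum>\<^sub>\<infinity>y\<in>-{x}. ?W y * (f y - f x))"
    by linarith
  from divide_right_mono[OF this less_imp_le[OF assms(2)]]
  show ?thesis
    using assms(2) unfolding frac_laplacian_def by (simp add: diff_divide_distrib)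
qed

section \<open>Positive solutions after multiplication by the integrating factor\<close>

locale positive_frac_diffusion =
  fixes E :: "'v rel" and \<theta> :: "'v \<Rightarrow> real" and w :: "'v \<Rightarrow> 'v \<Rightarrow> real"
    and \<epsilon> C\<^sub>0 c\<^sub>1 c\<^sub>2 :: real
    and u b :: "'v \<Rightarrow> real \<Rightarrow> real" and \<gamma> :: "real \<Rightarrow> real"
  assumes measure_pos: "\<And>z. \<theta> z > 0"
    and degree_finite: "frac_degree_sup E \<theta> w \<epsilon> < \<infinity>"
    and measure_finite: "measure_max \<theta> < \<infinity>"
    and omega_pos: "omega_min E \<theta> w \<epsilon> > 0"
    and u_pos: "\<And>z t. t > 0 \<Longrightarrow> u z t > 0"
    and solution: "frac_diffusion_solution E \<theta> w \<epsilon> b \<gamma> u"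
    and b_le: "\<And>z t. t > 0 \<Longrightarrow> b z t \<le> C\<^sub>0"
    and \<gamma>_le: "\<And>t. t > 0 \<Longrightarrow> \<gamma> t \<le> c\<^sub>1 + c\<^sub>2 / t"
begin

abbreviation D :: real where "D \<equiv> enn2real (frac_degree_sup E \<theta> w \<epsilon>)"
abbreviation M :: real where "M \<equiv> enn2real (measure_max \<theta>)"
abbreviation \<omega> :: real where "\<omega> \<equiv> enn2real (omega_min E \<theta> w \<epsilon>)"

lemma measure_le: "\<theta> z \<le> M"
proof -
  have "ennreal (\<theta> z) \<le> measure_max \<theta>" unfolding measure_max_def by (rule SUP_upper) simp
  then have "enn2real (ennreal (\<theta> z)) \<le> M" using measure_finite by (intro enn2real_mono) auto
  then show ?thesis using measure_pos[of z] by simp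
qed

lemma deriv_lower_bound:
  assumes "t > 0" and "finite F" "F \<subseteq> -{z}"
  shows "(\<Sum>y\<in>F. frac_weight E \<theta> w \<epsilon> z y * u y t) / \<theta> z - (D + C\<^sub>0 + c\<^sub>1 + c\<^sub>2 / t) * u z t
           \<le> deriv (u z) t"
proof -
  have eq: "frac_laplacian E \<theta> w \<epsilon> (\<lambda>y. u y t) z - b z t * u z t = deriv (u z) t + \<gamma> t * u z t"
    and summ: "(\<lambda>y. frac_weight E \<theta> w \<epsilon> z y * (u y t - u z t)) summable_on -{z}"
    using solution assms(1) unfolding frac_diffusion_solution_def by auto
  have "frac_weight E \<theta> w \<epsilon> z y \<ge> 0" if "y \<noteq> z" for y
    using omega_min_finite_and_le[OF omega_pos, of z y] that by auto
  then have "(\<Sum>y\<in>F. frac_weight E \<theta> w \<epsilon> z y * u y t) / \<theta> z - D * u z t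
      \<le> frac_laplacian E \<theta> w \<epsilon> (\<lambda>y. u y t) z"
    using degree_finite measure_pos u_pos assms summ
    by (intro frac_laplacian_lower_bound) (auto intro: less_imp_le)
  moreover have "(b z t + \<gamma> t) * u z t \<le> (C\<^sub>0 + c\<^sub>1 + c\<^sub>2 / t) * u z t"
    using b_le[of t z] \<gamma>_le[of t] u_pos[of t z] assms(1) by (intro mult_right_mono) auto
  ultimately show ?thesis using eq by (simp add: algebra_simps)
qed

definition factor :: "real \<Rightarrow> real" where
  "factor t = exp ((D + C\<^sub>0 + c\<^sub>1) * t) * t powr c\<^sub>2"

definition v :: "'v \<Rightarrow> real \<Rightarrow> real" where
  "v z t = factor t * u z t"

lemma factor_pos: "t > 0 \<Longrightarrow> factor t > 0"
  by (simp add: factor_def)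

lemma v_derivative:
  assumes "t > 0"
  shows "(v z has_real_derivative
           factor t * (deriv (u z) t + (D + C\<^sub>0 + c\<^sub>1 + c\<^sub>2 / t) * u z t)) (at t)"
proof -
  have "u z differentiable at t"
    using solution assms unfolding frac_diffusion_solution_def by auto
  then have du: "(u z has_real_derivative deriv (u z) t) (at t)"
    using DERIV_deriv_iff_real_differentiable by blast
  have df: "(factor has_real_derivative factor t * (D + C\<^sub>0 + c\<^sub>1 + c\<^sub>2 / t)) (at t)"
    unfolding factor_def using assms
    by (auto intro!: derivative_eq_intros simp: powr_diff field_simps)
  show ?thesis
    unfolding v_def using DERIV_mult[OF df du] by (simp add: algebra_simps)
qed

lemma v_mono:
  assumes "0 < s" "s \<le> t"
  shows "v z s \<le> v z t"
proof (rule DERIV_nonneg_imp_nondecreasing[OF assms(2)])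
  fix r assume "s \<le> r" "r \<le> t"
  then have "r > 0" using assms(1) by linarith
  have "0 \<le> deriv (u z) r + (D + C\<^sub>0 + c\<^sub>1 + c\<^sub>2 / r) * u z r"
    using deriv_lower_bound[OF \<open>r > 0\<close>, of "{}" z] by simp
  then show "\<exists>d. (v z has_real_derivative d) (at r) \<and> 0 \<le> d"
    using v_derivative[OF \<open>r > 0\<close>] factor_pos[OF \<open>r > 0\<close>] by (meson less_imp_le mult_nonneg_nonneg)
qed

text \<open>The jump from \<open>x\<close> to \<open>y\<close> feeds \<open>v y\<close> at a rate of at least \<open>\<omega> / M\<close> times \<open>v x\<close>, and by
  monotonicity \<open>v x\<close> never falls below its initial value.\<close>

lemma normalized_jump:
  assumes "0 < s" "s < t" "x \<noteq> y"
  shows "\<omega> / M * (t - s) * v x s \<le> v y t"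
proof -
  have "M > 0" using measure_le[of y] measure_pos[of y] by linarith
  \<comment> \<open>Subtracting the guaranteed linear growth leaves a function with nonnegative derivative.\<close>
  let ?g = "\<lambda>r. v y r - \<omega> / M * v x s * (r - s)"
  have "?g s \<le> ?g t"
  proof (rule DERIV_nonneg_imp_nondecreasing[where f = ?g])
    fix r assume r: "s \<le> r" "r \<le> t"
    then have "r > 0" using assms(1) by linarith
    let ?d = "factor r * (deriv (u y) r + (D + C\<^sub>0 + c\<^sub>1 + c\<^sub>2 / r) * u y r)"
    have "\<omega> / M \<le> frac_weight E \<theta> w \<epsilon> y x / \<theta> y"
      using omega_min_finite_and_le[OF omega_pos, of y x] assms(3) measure_le[of y] measure_pos[of y]
      by (intro frac_le) auto
    then have "\<omega> / M * u x r \<le> frac_weight E \<theta> w \<epsilon> y x / \<theta> y * u x r"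
      using u_pos[OF \<open>r > 0\<close>, of x] by (intro mult_right_mono) auto
    also have "\<dots> \<le> deriv (u y) r + (D + C\<^sub>0 + c\<^sub>1 + c\<^sub>2 / r) * u y r"
      using deriv_lower_bound[OF \<open>r > 0\<close>, of "{x}" y] assms(3) by simp
    finally have "factor r * (\<omega> / M * u x r) \<le> ?d"
      using factor_pos[OF \<open>r > 0\<close>] by (intro mult_left_mono) auto
    then have "\<omega> / M * v x r \<le> ?d" by (simp add: v_def mult_ac)
    moreover have "\<omega> / M * v x s \<le> \<omega> / M * v x r"
      using v_mono[OF assms(1) r(1)] by (intro mult_left_mono) auto
    moreover have "(?g has_real_derivative ?d - \<omega> / M * v x s) (at r)"
      using \<open>M > 0\<close> by (auto intro!: derivative_eq_intros v_derivative[OF \<open>r > 0\<close>])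
    ultimately show "\<exists>d. (?g has_real_derivative d) (at r) \<and> 0 \<le> d"
      by (intro exI[of _ "?d - \<omega> / M * v x s"]) auto
  qed (use assms in simp)
  moreover have "v y s \<ge> 0"
    using factor_pos[OF assms(1)] u_pos[OF assms(1)] by (simp add: v_def less_imp_le)
  ultimately show ?thesis by (simp add: mult_ac)
qed

lemma factor_ratio:
  assumes "0 < s" "s < t"
  shows "factor t / factor s = (t / s) powr c\<^sub>2 * exp ((D + C\<^sub>0 + c\<^sub>1) * (t - s))"
  using assms by (simp add: factor_def powr_divide exp_diff right_diff_distrib) (simp add: mult.commute)

lemma harnack_unit_weight:
  fixes \<eta> :: nat
  assumes "0 < s" "s < t" and \<eta>: "\<eta> = 0 \<longleftrightarrow> x = y"
  shows "u x s \<le> u y t * (t / s) powr c\<^sub>2 *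
           exp ((2 * D + C\<^sub>0 + c\<^sub>1) * (t - s) + 4 * M * real \<eta> ^ 2 / (\<omega> * (t - s)))"
proof -
  let ?e = "4 * M * real \<eta> ^ 2 / (\<omega> * (t - s))"
  have v_le: "v x s \<le> v y t * exp ?e"
  proof (cases "x = y")
    case True
    then show ?thesis using v_mono[OF assms(1) less_imp_le[OF assms(2)]] \<eta> by simp
  next
    case False
    have pos: "\<omega> > 0" "M > 0"
      using omega_min_finite_and_le(1)[OF omega_pos False] measure_le[of x] measure_pos[of x] by auto
    \<comment> \<open>The loss factor of one jump, to be absorbed by the exponential.\<close>
    let ?q = "M / (\<omega> * (t - s))"
    have "?q > 0" using pos assms by simp
    have "real \<eta> ^ 2 \<ge> 1" using \<eta> False by (simp add: one_le_power)
    then have "?q * 1 \<le> ?q * (4 * real \<eta> ^ 2)"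
      using \<open>?q > 0\<close> by (intro mult_left_mono) auto
    then have "?q \<le> ?e" by (simp add: mult_ac)
    then have "?q \<le> exp ?e" using exp_ge_add_one_self[of ?e] by linarith
    have "v x s \<le> v y t * ?q"
      using normalized_jump[OF assms(1,2) False] pos assms(2) by (simp add: field_simps)
    also have "\<dots> \<le> v y t * exp ?e"
      using \<open>?q \<le> exp ?e\<close> factor_pos[of t] u_pos[of t y] assms
      by (intro mult_left_mono) (auto simp: v_def intro!: less_imp_le)
    finally show ?thesis .
  qed
  have "u x s = v x s / factor s" using factor_pos[OF assms(1)] by (simp add: v_def)
  also have "\<dots> \<le> v y t * exp ?e / factor s"
    using v_le factor_pos[OF assms(1)] by (intro divide_right_mono) auto
  also have "\<dots> = u y t * (factor t / factor s) * exp ?e" by (simp add: v_def)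
  also have "\<dots> = u y t * (t / s) powr c\<^sub>2 * exp ((D + C\<^sub>0 + c\<^sub>1) * (t - s) + ?e)"
    by (simp add: factor_ratio[OF assms(1,2)] exp_add mult_ac)
  also have "\<dots> \<le> u y t * (t / s) powr c\<^sub>2 * exp ((2 * D + C\<^sub>0 + c\<^sub>1) * (t - s) + ?e)"
  proof -
    have "u y t * (t / s) powr c\<^sub>2 \<ge> 0" using u_pos[of t y] assms by simp
    moreover have "D * (t - s) \<ge> 0" using assms(2) by simp
    ultimately show ?thesis by (intro mult_left_mono) (auto simp: algebra_simps)
  qed
  finally show ?thesis .
qed

end

section \<open>The Harnack inequality\<close>

theorem corollary4p3:
  fixes E :: "'v rel" and \<theta> :: "'v \<Rightarrow> real" and w :: "'v \<Rightarrow> 'v \<Rightarrow> real"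
    and \<epsilon> C\<^sub>0 c\<^sub>1 c\<^sub>2 T\<^sub>1 T\<^sub>2 :: real
    and u b :: "'v \<Rightarrow> real \<Rightarrow> real" and \<gamma> :: "real \<Rightarrow> real"
    and x y :: 'v and \<eta> :: nat
  assumes "weighted_graph E \<theta> w" and "connected_graph E" and "locally_finite_graph E"
    and "stochastically_complete E \<theta> w"
    and "0 < \<epsilon>" and "\<epsilon> < 1"
    and "frac_degree_sup E \<theta> w \<epsilon> < \<infinity>"
    and "measure_max \<theta> < \<infinity>"
    and "omega_min E \<theta> w \<epsilon> > 0"
    and "\<And>z t. t > 0 \<Longrightarrow> u z t > 0"
    and "frac_diffusion_solution E \<theta> w \<epsilon> b \<gamma> u"
    and "\<And>z t. t > 0 \<Longrightarrow> \<bar>b z t\<bar> \<le> C\<^sub>0"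
    and "\<And>t. t > 0 \<Longrightarrow> \<gamma> t \<le> c\<^sub>1 + c\<^sub>2 / t"
    and "graph_dist E x y = \<eta>"
    and "0 < T\<^sub>1" and "T\<^sub>1 < T\<^sub>2"
  shows
    "(\<forall>\<alpha>. antimono_on {T\<^sub>1..T\<^sub>2} \<alpha> \<and> (\<forall>t\<in>{T\<^sub>1..T\<^sub>2}. \<alpha> t \<ge> 1) \<longrightarrow>
        u x T\<^sub>1 \<le> u y T\<^sub>2 * (T\<^sub>2 / T\<^sub>1) powr c\<^sub>2 *
          exp ((2 * enn2real (frac_degree_sup E \<theta> w \<epsilon>) + C\<^sub>0 + c\<^sub>1) * (T\<^sub>2 - T\<^sub>1) +
               (INF \<Gamma>\<in>shortest_paths E x y. \<Sum>k<\<eta>.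
                  8 * enn2real (measure_max \<theta>) * real \<eta> ^ 3 * time_weight \<alpha> T\<^sub>1 T\<^sub>2 \<eta> k /
                  (enn2real (omega_min E \<theta> w \<epsilon>) * (T\<^sub>2 - T\<^sub>1) ^ 3))))
     \<and>
     u x T\<^sub>1 \<le> u y T\<^sub>2 * (T\<^sub>2 / T\<^sub>1) powr c\<^sub>2 *
       exp ((2 * enn2real (frac_degree_sup E \<theta> w \<epsilon>) + C\<^sub>0 + c\<^sub>1) * (T\<^sub>2 - T\<^sub>1) +
            4 * enn2real (measure_max \<theta>) * real \<eta> ^ 2 /
            (enn2real (omega_min E \<theta> w \<epsilon>) * (T\<^sub>2 - T\<^sub>1)))"
proof -
  interpret positive_frac_diffusion E \<theta> w \<epsilon> C\<^sub>0 c\<^sub>1 c\<^sub>2 u b \<gamma>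
  proof
    show "\<theta> z > 0" for z using assms(1) by (simp add: weighted_graph_def)
    show "b z t \<le> C\<^sub>0" if "t > 0" for z t using assms(12)[OF that, of z] by linarith
    show "u z t > 0" if "t > 0" for z t using that by (rule assms(10))
    show "\<gamma> t \<le> c\<^sub>1 + c\<^sub>2 / t" if "t > 0" for t using that by (rule assms(13))
  qed (rule assms(7-9,11))+
  let ?e = "4 * M * real \<eta> ^ 2 / (\<omega> * (T\<^sub>2 - T\<^sub>1))"
  have "\<eta> = 0 \<longleftrightarrow> x = y" using graph_dist_eq_0_iff[OF assms(2), of x y] assms(14) by simp
  from harnack_unit_weight[OF assms(15,16) this]
  have unit: "u x T\<^sub>1 \<le> u y T\<^sub>2 * (T\<^sub>2 / T\<^sub>1) powr c\<^sub>2 *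
      exp ((2 * D + C\<^sub>0 + c\<^sub>1) * (T\<^sub>2 - T\<^sub>1) + ?e)" .
  have "u x T\<^sub>1 \<le> u y T\<^sub>2 * (T\<^sub>2 / T\<^sub>1) powr c\<^sub>2 *
      exp ((2 * D + C\<^sub>0 + c\<^sub>1) * (T\<^sub>2 - T\<^sub>1) +
        (INF \<Gamma>\<in>shortest_paths E x y. \<Sum>k<\<eta>.
           8 * M * real \<eta> ^ 3 * time_weight \<alpha> T\<^sub>1 T\<^sub>2 \<eta> k / (\<omega> * (T\<^sub>2 - T\<^sub>1) ^ 3)))"
    if "antimono_on {T\<^sub>1..T\<^sub>2} \<alpha>" "\<forall>t\<in>{T\<^sub>1..T\<^sub>2}. \<alpha> t \<ge> 1" for \<alpha>
  proof -
    have "?e \<le> (INF \<Gamma>\<in>shortest_paths E x y. \<Sum>k<\<eta>.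
        8 * M * real \<eta> ^ 3 * time_weight \<alpha> T\<^sub>1 T\<^sub>2 \<eta> k / (\<omega> * (T\<^sub>2 - T\<^sub>1) ^ 3))"
      using shortest_paths_nonempty[OF assms(2), of x y] that assms(16)
      by (intro cINF_greatest path_term_lower_bound) auto
    then have "exp ((2 * D + C\<^sub>0 + c\<^sub>1) * (T\<^sub>2 - T\<^sub>1) + ?e) \<le> exp ((2 * D + C\<^sub>0 + c\<^sub>1) * (T\<^sub>2 - T\<^sub>1) +
        (INF \<Gamma>\<in>shortest_paths E x y. \<Sum>k<\<eta>.
           8 * M * real \<eta> ^ 3 * time_weight \<alpha> T\<^sub>1 T\<^sub>2 \<eta> k / (\<omega> * (T\<^sub>2 - T\<^sub>1) ^ 3)))"
      by simp
    moreover have "u y T\<^sub>2 * (T\<^sub>2 / T\<^sub>1) powr c\<^sub>2 \<ge> 0"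
      using u_pos[of T\<^sub>2 y] assms(15,16) by simp
    ultimately show ?thesis using unit by (meson mult_left_mono order_trans)
  qed
  with unit show ?thesis by blast
qed

end
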